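(* Consider the relaxed Crank--Nicolson energy quadratization scheme (relaxed CN scheme) defined in the context, with relaxation parameter $\eta\in[0,1]$, for the quadratized system $\partial_t\Psi=-\mathcal{N}(\Psi)\mathcal{L}\Psi$, $\Psi=(\phi,q)^T$. The scheme is unconditionally energy stable: for every time step $\delta t>0$ (with no restriction on its size), every $\eta\in[0,1]$ and every $n\ge 1$, if $\Psi^{n+1}=(\phi^{n+1},q^{n+1})^T$ is produced by the scheme from $\Psi^{n-1}$ and $\Psi^n=(\phi^n,q^n)^T$, then $$\frac12\Big[(\phi^{n+1},\mathcal{L}_0\phi^{n+1})+\|q^{n+1}\|^2\Big]\;\le\;\frac12\Big[(\phi^{n},\mathcal{L}_0\phi^{n})+\|q^{n}\|^2\Big].$$
   Context: **Setting.** $\Omega$ is a bounded domain, $(f,g)=\int_\Omega fg\,d\mathbf{x}$ is the $L^2(\Omega)$ inner product (summed over components for vector-valued functions and for pairs such as $\Psi$), and $\|\cdot\|$ is the induced norm. The model is $\partial_t\phi=-\mathcal{G}\frac{\delta\mathcal{E}}{\delta\phi}$ with free energy $\mathcal{E}(\phi)=\int_\Omega e\,d\mathbf{x}$, where $e$ is the energy density. The mobility is $\mathcal{G}=\mathcal{G}_a+\mathcal{G}_s$, with $\mathcal{G}_s$ a symmetric positive semi-definite linear operator and $\mathcal{G}_a$ a skew-symmetric linear operator, both with respect to $(\cdot,\cdot)$. $\mathcal{L}_0$ is a linear operator separated from $e$; it is self-adjoint and positive semi-definite, with square root $\mathcal{L}_0^{1/2}$. Boundary conditions (e.g. periodic)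 are such that all boundary contributions in integrations by parts vanish, and all functions are regular enough for the expressions below to make sense. **Auxiliary variable.** Put $$q=h(\phi)=\sqrt{2\Big(e-\tfrac12|\mathcal{L}_0^{1/2}\phi|^2+\tfrac{A_0}{|\Omega|}\Big)},$$ where $A_0>0$ is a constant such that $h(\phi)$ is a well-defined real function. It is assumed that $q=q(\phi,\nabla\phi)$, and we write $g(\phi)=\frac{\partial q}{\partial\phi}$ and $\mathbf{G}(\nabla\phi)=\frac{\partial q}{\partial\nabla\phi}$. **Quadratized system.** The model is rewritten as $$\partial_t\phi=-(\mathcal{G}_a+\mathcal{G}_s)\big[\mathcal{L}_0\phi+q\,g(\phi)-\nabla\cdot(q\,\mathbf{G}(\nabla\phi))\big],\qquad \partial_t q=g(\phi)\,\partial_t\phi+\mathbf{G}(\nabla\phi):\nabla\partial_t\phi.$$ In compact form, with $\Psi=(\phi,q)^T$, this is $\partial_t\Psi=-\mathcal{N}(\Psi)\mathcal{L}\Psi$, where $$\mathcal{L}=\begin{bmatrix}\mathcal{L}_0&0\\ 0&1\end{bmatrix},\qquad \mathcal{N}(\Psi)=\mathcal{N}_0^*(\mathcal{G}_a+\mathcal{G}_s)\mathcal{N}_0.$$ Here $\mathcal{N}_0=\mathcal{N}_0(\Psi)$ and $\mathcal{N}_0^*$ are mutually adjoint, given by $$\mathcal{N}_0^*v=\begin{bmatrix}v\\ g(\phi)v+\mathbf{G}(\nabla\phi):\nabla v\end{bmatrix},\qquad \mathcal{N}_0\begin{bmatrix}u\\ p\end{bmatrix}=u+g(\phi)p-\nabla\cdot(p\,\mathbf{G}(\nabla\phi)).$$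 **Relaxed CN scheme.** Let $\delta t>0$ and $\eta\in[0,1]$. Given $\Psi^{n-1}=(\phi^{n-1},q^{n-1})^T$ and $\Psi^n=(\phi^n,q^n)^T$, set $\overline{\Psi}^{n+\frac12}=\frac32\Psi^n-\frac12\Psi^{n-1}$. Step 1: find $\hat\Psi^{n+1}=(\phi^{n+1},\hat q^{n+1})^T$ such that, with $\hat\Psi^{n+\frac12}=\frac12\hat\Psi^{n+1}+\frac12\Psi^n$, $$\frac{\hat\Psi^{n+1}-\Psi^n}{\delta t}=-\mathcal{N}(\overline\Psi^{n+\frac12})\,\mathcal{L}\hat\Psi^{n+\frac12}.$$ Step 2: set $q^{n+1}=\xi_0\hat q^{n+1}+(1-\xi_0)h(\phi^{n+1})$ with $$\xi_0=\max\Big\{0,\frac{-b-\sqrt{b^2-4ac}}{2a}\Big\},$$ where $$a=\tfrac12\|\hat q^{n+1}-h(\phi^{n+1})\|^2,\qquad b=(\hat q^{n+1},h(\phi^{n+1}))-\|h(\phi^{n+1})\|^2,$$ $$c=\tfrac12\|h(\phi^{n+1})\|^2-\tfrac12\|\hat q^{n+1}\|^2-\delta t\,\eta\,\big(\mathcal{L}\hat\Psi^{n+\frac12},\mathcal{N}(\overline\Psi^{n+\frac12})\mathcal{L}\hat\Psi^{n+\frac12}\big).$$ If $a=0$, i.e. $\hat q^{n+1}=h(\phi^{n+1})$, the value of $\xi_0$ is immaterial and $q^{n+1}=\hat q^{n+1}=h(\phi^{n+1})$. The new iterate is $\Psi^{n+1}=(\phi^{n+1},q^{n+1})^T$. *)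

theory Defs
  imports "HOL-Analysis.Analysis"
begin

section \<open>The $L^2(\Omega)$ inner product and operators on function spaces\<close>

text \<open>
  A function on \<open>\<Omega>\<close> is represented by a total function of which only the values on \<open>\<Omega>\<close> matter.
  On product-valued functions such as \<open>\<Psi> = (\<phi>, q)\<close> the inner product of the values is the sum
  over the components, so \<open>l2_inner\<close> also covers pairs.
\<close>

definition l2_inner :: "'a::euclidean_space set \<Rightarrow> ('a \<Rightarrow> 'b::euclidean_space) \<Rightarrow> ('a \<Rightarrow> 'b) \<Rightarrow> real"
  where "l2_inner \<Omega> u v = (LINT x|lebesgue_on \<Omega>. u x \<bullet> v x)"

definition l2_norm :: "'a::euclidean_space set \<Rightarrow> ('a \<Rightarrow> 'b::euclidean_space) \<Rightarrow> real"
  where "l2_norm \<Omega> u = sqrt (l2_inner \<Omega> u u)"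

definition L2 :: "'a::euclidean_space set \<Rightarrow> ('a \<Rightarrow> 'b::euclidean_space) set"
  where "L2 \<Omega> = {u. u \<in> borel_measurable (lebesgue_on \<Omega>) \<and>
                    integrable (lebesgue_on \<Omega>) (\<lambda>x. (norm (u x))\<^sup>2)}"

definition function_space :: "'a::euclidean_space set \<Rightarrow> ('a \<Rightarrow> 'b::euclidean_space) set \<Rightarrow> bool"
  where "function_space \<Omega> V \<longleftrightarrow>
    V \<subseteq> L2 \<Omega> \<and>
    (\<lambda>x. 0) \<in> V \<and>
    (\<forall>u\<in>V. \<forall>v\<in>V. (\<lambda>x. u x + v x) \<in> V) \<and>
    (\<forall>c. \<forall>u\<in>V. (\<lambda>x. c *\<^sub>R u x) \<in> V) \<and>
    (\<forall>u\<in>V. \<forall>v. (\<forall>x\<in>\<Omega>. v x = u x) \<longrightarrow> v \<in> V)"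

text \<open>
  A (possibly unbounded) linear operator in $L^2(\Omega)$ with domain \<open>D\<close>. The last clause says that
  the operator does not see the values of functions outside \<open>\<Omega>\<close>.
\<close>

definition linear_operator ::
    "'a::euclidean_space set \<Rightarrow> ('a \<Rightarrow> 'b::euclidean_space) set \<Rightarrow>
     (('a \<Rightarrow> 'b) \<Rightarrow> ('a \<Rightarrow> 'b)) \<Rightarrow> bool"
  where "linear_operator \<Omega> D A \<longleftrightarrow>
    A ` D \<subseteq> L2 \<Omega> \<and>
    (\<forall>u\<in>D. \<forall>v\<in>D. \<forall>x\<in>\<Omega>. A (\<lambda>y. u y + v y) x = A u x + A v x) \<and>
    (\<forall>c. \<forall>u\<in>D. \<forall>x\<in>\<Omega>. A (\<lambda>y. c *\<^sub>R u y) x = c *\<^sub>R A u x) \<and>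
    (\<forall>u\<in>D. \<forall>v\<in>D. (\<forall>x\<in>\<Omega>. u x = v x) \<longrightarrow> (\<forall>x\<in>\<Omega>. A u x = A v x))"

definition symmetric_operator ::
    "'a::euclidean_space set \<Rightarrow> ('a \<Rightarrow> 'b::euclidean_space) set \<Rightarrow>
     (('a \<Rightarrow> 'b) \<Rightarrow> ('a \<Rightarrow> 'b)) \<Rightarrow> bool"
  where "symmetric_operator \<Omega> D A \<longleftrightarrow> (\<forall>u\<in>D. \<forall>v\<in>D. l2_inner \<Omega> (A u) v = l2_inner \<Omega> u (A v))"

definition skew_operator ::
    "'a::euclidean_space set \<Rightarrow> ('a \<Rightarrow> 'b::euclidean_space) set \<Rightarrow>
     (('a \<Rightarrow> 'b) \<Rightarrow> ('a \<Rightarrow> 'b)) \<Rightarrow> bool"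
  where "skew_operator \<Omega> D A \<longleftrightarrow> (\<forall>u\<in>D. \<forall>v\<in>D. l2_inner \<Omega> (A u) v = - l2_inner \<Omega> u (A v))"

definition psd_operator ::
    "'a::euclidean_space set \<Rightarrow> ('a \<Rightarrow> 'b::euclidean_space) set \<Rightarrow>
     (('a \<Rightarrow> 'b) \<Rightarrow> ('a \<Rightarrow> 'b)) \<Rightarrow> bool"
  where "psd_operator \<Omega> D A \<longleftrightarrow> (\<forall>u\<in>D. 0 \<le> l2_inner \<Omega> u (A u))"


section \<open>Differential calculus\<close>

text \<open>
  For \<open>\<phi> :: real^'d \<Rightarrow> real^'m\<close> the gradient $\nabla\phi$ is the Jacobian matrix, of type \<open>real^'d^'m\<close>;
  the double contraction of two such matrices is their inner product in the library.
\<close>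

definition nabla :: "(real^'d \<Rightarrow> real^'m) \<Rightarrow> real^'d \<Rightarrow> real^'d^'m"
  where "nabla \<phi> x = jacobian \<phi> (at x)"

definition divergence :: "(real^'d \<Rightarrow> real^'d) \<Rightarrow> real^'d \<Rightarrow> real"
  where "divergence w x = trace (jacobian w (at x))"

definition row_divergence :: "(real^'d \<Rightarrow> real^'d^'m) \<Rightarrow> real^'d \<Rightarrow> real^'m"
  where "row_divergence F x = (\<chi> i. divergence (\<lambda>y. F y $ i) x)"

definition gradient :: "('b::euclidean_space \<Rightarrow> real) \<Rightarrow> 'b \<Rightarrow> 'b"
  where "gradient f z = (\<Sum>b\<in>Basis. frechet_derivative f (at z) b *\<^sub>R b)"


section \<open>The auxiliary variable and the quadratized system\<close>

definition aux_h ::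
    "(real^'d) set \<Rightarrow> ((real^'d \<Rightarrow> real^'m) \<Rightarrow> real^'d \<Rightarrow> real) \<Rightarrow>
     ((real^'d \<Rightarrow> real^'m) \<Rightarrow> real^'d \<Rightarrow> real^'m) \<Rightarrow> real \<Rightarrow>
     (real^'d \<Rightarrow> real^'m) \<Rightarrow> real^'d \<Rightarrow> real"
  where "aux_h \<Omega> e L0half A0 \<phi> x =
    sqrt (2 * (e \<phi> x - 1/2 * (norm (L0half \<phi> x))\<^sup>2 + A0 / measure lebesgue \<Omega>))"

text \<open>
  \<open>Q\<close> is the function of two arguments expressing $q = q(\phi, \nabla\phi)$; its partial gradients
  give $g = \partial q/\partial\phi$ and $\mathbf{G} = \partial q/\partial\nabla\phi$.
\<close>

definition g_fun ::
    "(real^'m \<Rightarrow> real^'d^'m \<Rightarrow> real) \<Rightarrow> (real^'d \<Rightarrow> real^'m) \<Rightarrow> real^'d \<Rightarrow> real^'m"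
  where "g_fun Q \<phi> x = gradient (\<lambda>u. Q u (nabla \<phi> x)) (\<phi> x)"

definition G_fun ::
    "(real^'m \<Rightarrow> real^'d^'m \<Rightarrow> real) \<Rightarrow> (real^'d \<Rightarrow> real^'m) \<Rightarrow> real^'d \<Rightarrow> real^'d^'m"
  where "G_fun Q \<phi> x = gradient (\<lambda>M. Q (\<phi> x) M) (nabla \<phi> x)"

definition N0_adj ::
    "(real^'m \<Rightarrow> real^'d^'m \<Rightarrow> real) \<Rightarrow> (real^'d \<Rightarrow> real^'m) \<Rightarrow>
     (real^'d \<Rightarrow> real^'m) \<Rightarrow> real^'d \<Rightarrow> (real^'m) \<times> real"
  where "N0_adj Q \<phi> v x = (v x, g_fun Q \<phi> x \<bullet> v x + G_fun Q \<phi> x \<bullet> nabla v x)"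

definition N0 ::
    "(real^'m \<Rightarrow> real^'d^'m \<Rightarrow> real) \<Rightarrow> (real^'d \<Rightarrow> real^'m) \<Rightarrow>
     (real^'d \<Rightarrow> (real^'m) \<times> real) \<Rightarrow> real^'d \<Rightarrow> real^'m"
  where "N0 Q \<phi> f x =
    fst (f x) + snd (f x) *\<^sub>R g_fun Q \<phi> x - row_divergence (\<lambda>y. snd (f y) *\<^sub>R G_fun Q \<phi> y) x"

definition L_op ::
    "((real^'d \<Rightarrow> real^'m) \<Rightarrow> real^'d \<Rightarrow> real^'m) \<Rightarrow>
     (real^'d \<Rightarrow> (real^'m) \<times> real) \<Rightarrow> real^'d \<Rightarrow> (real^'m) \<times> real"
  where "L_op L0 \<Psi> x = (L0 (fst \<circ> \<Psi>) x, snd (\<Psi> x))"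

definition mobility ::
    "((real^'d \<Rightarrow> real^'m) \<Rightarrow> real^'d \<Rightarrow> real^'m) \<Rightarrow> ((real^'d \<Rightarrow> real^'m) \<Rightarrow> real^'d \<Rightarrow> real^'m) \<Rightarrow>
     (real^'d \<Rightarrow> real^'m) \<Rightarrow> real^'d \<Rightarrow> real^'m"
  where "mobility Ga Gs \<mu> x = Ga \<mu> x + Gs \<mu> x"

definition N_op ::
    "((real^'d \<Rightarrow> real^'m) \<Rightarrow> real^'d \<Rightarrow> real^'m) \<Rightarrow> ((real^'d \<Rightarrow> real^'m) \<Rightarrow> real^'d \<Rightarrow> real^'m) \<Rightarrow>
     (real^'m \<Rightarrow> real^'d^'m \<Rightarrow> real) \<Rightarrow>
     (real^'d \<Rightarrow> (real^'m) \<times> real) \<Rightarrow> (real^'d \<Rightarrow> (real^'m) \<times> real) \<Rightarrow> real^'d \<Rightarrow> (real^'m) \<times> real"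
  where "N_op Ga Gs Q \<Psi> f = N0_adj Q (fst \<circ> \<Psi>) (mobility Ga Gs (N0 Q (fst \<circ> \<Psi>) f))"

definition state_space ::
    "(real^'d \<Rightarrow> real^'m) set \<Rightarrow> (real^'d \<Rightarrow> real) set \<Rightarrow> (real^'d \<Rightarrow> (real^'m) \<times> real) set"
  where "state_space V W = {\<Psi>. fst \<circ> \<Psi> \<in> V \<and> snd \<circ> \<Psi> \<in> W}"

text \<open>
  The standing assumptions. The function spaces encode the regularity and the boundary conditions:
  \<^item> \<open>V\<close>: phase fields \<open>\<phi>\<close>, the domain of \<open>\<L>\<^sub>0\<close>;
  \<^item> \<open>V'\<close>: the domain of the square root of \<open>\<L>\<^sub>0\<close>;
  \<^item> \<open>W\<close>: auxiliary variables \<open>q\<close>;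
  \<^item> \<open>D\<close>: chemical potentials, the domain of the mobility operators;
  \<^item> \<open>T\<close>: fields \<open>v\<close> to which \<open>\<N>\<^sub>0\<^sup>*\<close> is applied, such as \<open>\<partial>\<^sub>t\<phi>\<close>.

  The divergence in \<open>no_boundary_term\<close> is that of the flux \<open>q \<^bold>G\<^sup>Tv\<close>, so its integral is the boundary
  contribution when $\int_\Omega q\,\mathbf{G}:\nabla v$ is integrated by parts. Adjointness of
  \<open>N0\<close> and \<open>N0_adj\<close> is not assumed.
\<close>

locale quadratization_model =
  fixes \<Omega> :: "(real^'d) set"
    and V V' D T :: "(real^'d \<Rightarrow> real^'m) set"
    and W :: "(real^'d \<Rightarrow> real) set"
    and L0 L0half Ga Gs :: "(real^'d \<Rightarrow> real^'m) \<Rightarrow> real^'d \<Rightarrow> real^'m"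
    and e :: "(real^'d \<Rightarrow> real^'m) \<Rightarrow> real^'d \<Rightarrow> real"
    and A0 :: real
    and Q :: "real^'m \<Rightarrow> real^'d^'m \<Rightarrow> real"
  assumes domain: "open \<Omega>" "connected \<Omega>" "bounded \<Omega>" "\<Omega> \<noteq> {}"
    and spaces: "function_space \<Omega> V" "function_space \<Omega> V'" "function_space \<Omega> W"
      "function_space \<Omega> D" "function_space \<Omega> T"
    and L0: "linear_operator \<Omega> V L0" "symmetric_operator \<Omega> V L0" "psd_operator \<Omega> V L0"
    and L0half: "V \<subseteq> V'" "L0half ` V \<subseteq> V'"
      "linear_operator \<Omega> V' L0half" "symmetric_operator \<Omega> V' L0half" "psd_operator \<Omega> V' L0half"
      "\<And>\<phi> x. \<phi> \<in> V \<Longrightarrow> x \<in> \<Omega> \<Longrightarrow> L0half (L0half \<phi>) x = L0 \<phi> x"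
    and Ga: "linear_operator \<Omega> D Ga" "skew_operator \<Omega> D Ga"
    and Gs: "linear_operator \<Omega> D Gs" "symmetric_operator \<Omega> D Gs" "psd_operator \<Omega> D Gs"
    and A0_pos: "A0 > 0"
    and h_real: "\<And>\<phi> x. \<phi> \<in> V \<Longrightarrow> x \<in> \<Omega> \<Longrightarrow>
      e \<phi> x - 1/2 * (norm (L0half \<phi> x))\<^sup>2 + A0 / measure lebesgue \<Omega> \<ge> 0"
    and h_eq_Q: "\<And>\<phi> x. \<phi> \<in> V \<Longrightarrow> x \<in> \<Omega> \<Longrightarrow>
      aux_h \<Omega> e L0half A0 \<phi> x = Q (\<phi> x) (nabla \<phi> x)"
    and Q_differentiable: "\<And>\<phi> x. \<phi> \<in> V \<Longrightarrow> x \<in> \<Omega> \<Longrightarrow>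
      (\<lambda>u. Q u (nabla \<phi> x)) differentiable at (\<phi> x)"
      "\<And>\<phi> x. \<phi> \<in> V \<Longrightarrow> x \<in> \<Omega> \<Longrightarrow> (\<lambda>M. Q (\<phi> x) M) differentiable at (nabla \<phi> x)"
    and regular_V: "\<And>\<phi> x. \<phi> \<in> V \<Longrightarrow> x \<in> \<Omega> \<Longrightarrow> \<phi> differentiable at x"
      "\<And>\<phi>. \<phi> \<in> V \<Longrightarrow> aux_h \<Omega> e L0half A0 \<phi> \<in> W"
    and regular_T: "\<And>v x. v \<in> T \<Longrightarrow> x \<in> \<Omega> \<Longrightarrow> v differentiable at x"
      "\<And>\<phi> v. \<phi> \<in> V \<Longrightarrow> v \<in> T \<Longrightarrow> N0_adj Q \<phi> v \<in> L2 \<Omega>"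
    and regular_flux: "\<And>\<phi> q x. \<phi> \<in> V \<Longrightarrow> q \<in> W \<Longrightarrow> x \<in> \<Omega> \<Longrightarrow>
      (\<lambda>y. q y *\<^sub>R G_fun Q \<phi> y) differentiable at x"
    and N0_maps: "\<And>\<phi> \<Psi>. \<phi> \<in> V \<Longrightarrow> \<Psi> \<in> state_space V W \<Longrightarrow> N0 Q \<phi> (L_op L0 \<Psi>) \<in> D"
    and mobility_maps: "\<And>\<mu>. \<mu> \<in> D \<Longrightarrow> mobility Ga Gs \<mu> \<in> T"
    and no_boundary_term: "\<And>\<phi> q v. \<phi> \<in> V \<Longrightarrow> q \<in> W \<Longrightarrow> v \<in> T \<Longrightarrow>
      has_bochner_integral (lebesgue_on \<Omega>)
        (divergence (\<lambda>y. v y v* (q y *\<^sub>R G_fun Q \<phi> y))) 0"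


section \<open>The relaxed Crank--Nicolson scheme\<close>

definition relax_a :: "'a::euclidean_space set \<Rightarrow> ('a \<Rightarrow> real) \<Rightarrow> ('a \<Rightarrow> real) \<Rightarrow> real"
  where "relax_a \<Omega> qh h = 1/2 * (l2_norm \<Omega> (\<lambda>x. qh x - h x))\<^sup>2"

definition relax_b :: "'a::euclidean_space set \<Rightarrow> ('a \<Rightarrow> real) \<Rightarrow> ('a \<Rightarrow> real) \<Rightarrow> real"
  where "relax_b \<Omega> qh h = l2_inner \<Omega> qh h - (l2_norm \<Omega> h)\<^sup>2"

text \<open>\<open>d\<close> stands for $\delta t\,\eta\,(\mathcal{L}\hat\Psi^{n+1/2}, \mathcal{N}\mathcal{L}\hat\Psi^{n+1/2})$.\<close>

definition relax_c :: "'a::euclidean_space set \<Rightarrow> ('a \<Rightarrow> real) \<Rightarrow> ('a \<Rightarrow> real) \<Rightarrow> real \<Rightarrow> real"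
  where "relax_c \<Omega> qh h d = 1/2 * (l2_norm \<Omega> h)\<^sup>2 - 1/2 * (l2_norm \<Omega> qh)\<^sup>2 - d"

text \<open>
  \<open>\<Psi>m\<close>, \<open>\<Psi>\<close>, \<open>\<Psi>new\<close> are $\Psi^{n-1}$, $\Psi^n$, $\Psi^{n+1}$, and \<open>\<Psi>hat\<close> is the solution
  $\hat\Psi^{n+1}$ of the first step. When \<open>a = 0\<close> any value of \<open>\<xi>0\<close> is admitted.
\<close>

definition relaxed_CN_step ::
    "(real^'d) set \<Rightarrow> (real^'d \<Rightarrow> real^'m) set \<Rightarrow> (real^'d \<Rightarrow> real) set \<Rightarrow>
     ((real^'d \<Rightarrow> real^'m) \<Rightarrow> real^'d \<Rightarrow> real^'m) \<Rightarrow> ((real^'d \<Rightarrow> real^'m) \<Rightarrow> real^'d \<Rightarrow> real^'m) \<Rightarrow>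
     ((real^'d \<Rightarrow> real^'m) \<Rightarrow> real^'d \<Rightarrow> real^'m) \<Rightarrow> ((real^'d \<Rightarrow> real^'m) \<Rightarrow> real^'d \<Rightarrow> real^'m) \<Rightarrow>
     ((real^'d \<Rightarrow> real^'m) \<Rightarrow> real^'d \<Rightarrow> real) \<Rightarrow> real \<Rightarrow> (real^'m \<Rightarrow> real^'d^'m \<Rightarrow> real) \<Rightarrow>
     real \<Rightarrow> real \<Rightarrow> (real^'d \<Rightarrow> (real^'m) \<times> real) \<Rightarrow> (real^'d \<Rightarrow> (real^'m) \<times> real) \<Rightarrow>
     (real^'d \<Rightarrow> (real^'m) \<times> real) \<Rightarrow> bool"
  where "relaxed_CN_step \<Omega> V W L0 L0half Ga Gs e A0 Q \<delta>t \<eta> \<Psi>m \<Psi> \<Psi>new \<longleftrightarrow>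
    (\<exists>\<Psi>hat \<in> state_space V W. \<exists>\<xi>0 :: real.
      let \<Psi>bar = (\<lambda>x. (3/2) *\<^sub>R \<Psi> x - (1/2) *\<^sub>R \<Psi>m x);
          \<Psi>half = (\<lambda>x. (1/2) *\<^sub>R \<Psi>hat x + (1/2) *\<^sub>R \<Psi> x);
          L\<Psi> = L_op L0 \<Psi>half;
          NL\<Psi> = N_op Ga Gs Q \<Psi>bar L\<Psi>;
          qh = snd \<circ> \<Psi>hat;
          h = aux_h \<Omega> e L0half A0 (fst \<circ> \<Psi>hat);
          a = relax_a \<Omega> qh h;
          b = relax_b \<Omega> qh h;
          c = relax_c \<Omega> qh h (\<delta>t * \<eta> * l2_inner \<Omega> L\<Psi> NL\<Psi>)
      in (\<forall>x\<in>\<Omega>. (\<Psi>hat x - \<Psi> x) /\<^sub>R \<delta>t = - NL\<Psi> x) \<and>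
         (a \<noteq> 0 \<longrightarrow> \<xi>0 = max 0 ((- b - sqrt (b\<^sup>2 - 4 * a * c)) / (2 * a))) \<and>
         (\<forall>x\<in>\<Omega>. \<Psi>new x = (fst (\<Psi>hat x), \<xi>0 * qh x + (1 - \<xi>0) * h x)))"

end

theory Submission
  imports Defs
begin

text \<open>
  The midpoint rule makes the quadratic energy change in the first step by exactly
  \<open>- \<delta>t (\<L>\<Psi>, \<N>\<L>\<Psi>)\<close>, and since \<open>\<N> = \<N>\<^sub>0\<^sup>* (\<G>\<^sub>a + \<G>\<^sub>s) \<N>\<^sub>0\<close> with adjoint outer factors this pairing
  equals \<open>(\<mu>, \<G>\<^sub>s \<mu>) \<ge> 0\<close> with \<open>\<mu> = \<N>\<^sub>0\<L>\<Psi>\<close>. In the second step the polynomial \<open>a\<xi>\<^sup>2 + b\<xi> + c\<close> measures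
  by how much the relaxed energy exceeds the first-step energy plus the fraction \<open>\<eta>\<close> of that
  dissipation. It is nonpositive at \<open>\<xi> = 1\<close>, so \<open>\<xi>\<^sub>0\<close>, the smaller root cut off at \<open>0\<close>, lies between
  its roots and keeps the excess nonpositive.
\<close>

section \<open>Bilinearity of the $L^2$ inner product\<close>

lemma l2_inner_commute: "l2_inner \<Omega> u v = l2_inner \<Omega> v u"
  by (simp add: l2_inner_def inner_commute)

lemma l2_inner_cong:
  assumes "\<And>x. x \<in> \<Omega> \<Longrightarrow> u x = u' x" "\<And>x. x \<in> \<Omega> \<Longrightarrow> v x = v' x"
  shows "l2_inner \<Omega> u v = l2_inner \<Omega> u' v'"
  unfolding l2_inner_def using assms by (intro Bochner_Integration.integral_cong) auto

lemma l2_inner_self_nonneg: "0 \<le> l2_inner \<Omega> u u"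
  unfolding l2_inner_def by (intro Bochner_Integration.integral_nonneg) simp

lemma l2_norm_square: "(l2_norm \<Omega> u)\<^sup>2 = l2_inner \<Omega> u u"
  by (simp add: l2_norm_def l2_inner_self_nonneg)

text \<open>The Bochner integral is additive only on integrable functions, so every bilinearity
  argument below passes through this fact. Cauchy-Schwarz followed by 2st <= s^2 + t^2 supplies the
  dominating function.\<close>

lemma integrable_inner_L2:
  assumes "u \<in> L2 \<Omega>" "v \<in> L2 \<Omega>"
  shows "integrable (lebesgue_on \<Omega>) (\<lambda>x. u x \<bullet> v x)"
proof (rule Bochner_Integration.integrable_bound)
  show "integrable (lebesgue_on \<Omega>) (\<lambda>x. (norm (u x))\<^sup>2 + (norm (v x))\<^sup>2)"
    using assms by (auto simp: L2_def)
  show "(\<lambda>x. u x \<bullet> v x) \<in> borel_measurable (lebesgue_on \<Omega>)"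
    using assms by (auto simp: L2_def)
  have "\<bar>y \<bullet> z\<bar> \<le> (norm y)\<^sup>2 + (norm z)\<^sup>2" for y z :: 'b
  proof -
    have "\<bar>y \<bullet> z\<bar> \<le> norm y * norm z"
      by (rule Cauchy_Schwarz_ineq2)
    also have "\<dots> \<le> (norm y)\<^sup>2 + (norm z)\<^sup>2"
      using sum_squares_bound[of "norm y" "norm z"] mult_nonneg_nonneg[OF norm_ge_zero norm_ge_zero, of y z]
      by linarith
    finally show ?thesis .
  qed
  then show "AE x in lebesgue_on \<Omega>. norm (u x \<bullet> v x) \<le> norm ((norm (u x))\<^sup>2 + (norm (v x))\<^sup>2)"
    by simp
qed

lemma l2_inner_lincomb_left:
  assumes "u \<in> L2 \<Omega>" "v \<in> L2 \<Omega>" "w \<in> L2 \<Omega>"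
  shows "l2_inner \<Omega> (\<lambda>x. s *\<^sub>R u x + t *\<^sub>R v x) w = s * l2_inner \<Omega> u w + t * l2_inner \<Omega> v w"
  using integrable_inner_L2[OF assms(1,3)] integrable_inner_L2[OF assms(2,3)]
  by (simp add: l2_inner_def inner_add_left)

lemma l2_inner_lincomb_right:
  assumes "u \<in> L2 \<Omega>" "v \<in> L2 \<Omega>" "w \<in> L2 \<Omega>"
  shows "l2_inner \<Omega> w (\<lambda>x. s *\<^sub>R u x + t *\<^sub>R v x) = s * l2_inner \<Omega> w u + t * l2_inner \<Omega> w v"
  using l2_inner_lincomb_left[OF assms] by (simp add: l2_inner_commute)

text \<open>A function of zero norm vanishes almost everywhere, hence so does its product with any
  \<open>v\<close>. This serves the degenerate relaxation \<open>a = 0\<close>, where the two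
  candidates for q agree only almost everywhere.\<close>

lemma l2_inner_eq_0_if_self_eq_0:
  assumes "u \<in> L2 \<Omega>" "l2_inner \<Omega> u u = 0"
  shows "l2_inner \<Omega> u v = 0"
proof -
  have "AE x in lebesgue_on \<Omega>. u x \<bullet> u x = 0"
    using assms integrable_inner_L2[OF assms(1,1)]
    by (simp add: l2_inner_def integral_nonneg_eq_0_iff_AE)
  then have "AE x in lebesgue_on \<Omega>. u x \<bullet> v x = 0"
    by eventually_elim simp
  then show ?thesis
    unfolding l2_inner_def by (rule integral_eq_zero_AE)
qed

lemma L2_pairI:
  assumes "fst \<circ> f \<in> L2 \<Omega>" "snd \<circ> f \<in> L2 \<Omega>"
  shows "f \<in> L2 \<Omega>"
proof -
  have "(\<lambda>x. (fst (f x), snd (f x))) \<in> borel_measurable (lebesgue_on \<Omega>)"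
    using assms by (intro borel_measurable_Pair) (auto simp: L2_def o_def)
  moreover have "integrable (lebesgue_on \<Omega>) (\<lambda>x. (norm (fst (f x)))\<^sup>2 + (norm (snd (f x)))\<^sup>2)"
    using assms by (intro Bochner_Integration.integrable_add) (auto simp: L2_def o_def)
  ultimately show ?thesis
    by (simp add: L2_def norm_prod_def)
qed

lemma l2_inner_pair:
  assumes "fst \<circ> f \<in> L2 \<Omega>" "snd \<circ> f \<in> L2 \<Omega>" "fst \<circ> g \<in> L2 \<Omega>" "snd \<circ> g \<in> L2 \<Omega>"
  shows "l2_inner \<Omega> f g = l2_inner \<Omega> (fst \<circ> f) (fst \<circ> g) + l2_inner \<Omega> (snd \<circ> f) (snd \<circ> g)"
  using integrable_inner_L2[OF assms(1,3)] integrable_inner_L2[OF assms(2,4)]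
  by (simp add: l2_inner_def inner_prod_def)

section \<open>Closure rules for function spaces and linear operators\<close>

lemma function_space_scaleR: "function_space \<Omega> V \<Longrightarrow> u \<in> V \<Longrightarrow> (\<lambda>x. c *\<^sub>R u x) \<in> V"
  by (simp add: function_space_def)

lemma function_space_lincomb:
  assumes "function_space \<Omega> V" "u \<in> V" "v \<in> V"
  shows "(\<lambda>x. s *\<^sub>R u x + t *\<^sub>R v x) \<in> V"
proof -
  have "\<forall>u\<in>V. \<forall>v\<in>V. (\<lambda>x. u x + v x) \<in> V"
    using assms(1) unfolding function_space_def by - (elim conjE)
  from bspec[OF bspec[OF this function_space_scaleR] function_space_scaleR] show ?thesis
    using assms by simp
qed

lemma function_space_L2: "function_space \<Omega> V \<Longrightarrow> u \<in> V \<Longrightarrow> u \<in> L2 \<Omega>"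
  by (auto simp only: function_space_def)

lemma function_space_cong:
  assumes "function_space \<Omega> V" "u \<in> V" "\<And>x. x \<in> \<Omega> \<Longrightarrow> v x = u x"
  shows "v \<in> V"
proof -
  have "\<forall>u\<in>V. \<forall>v. (\<forall>x\<in>\<Omega>. v x = u x) \<longrightarrow> v \<in> V"
    using assms(1) unfolding function_space_def by - (elim conjE)
  then show ?thesis
    using assms(2,3) by blast
qed

lemma linear_operator_L2: "linear_operator \<Omega> D A \<Longrightarrow> u \<in> D \<Longrightarrow> A u \<in> L2 \<Omega>"
  by (auto simp only: linear_operator_def)

lemma linear_operator_cong:
  assumes "linear_operator \<Omega> D A" "u \<in> D" "v \<in> D" "\<And>x. x \<in> \<Omega> \<Longrightarrow> u x = v x" "x \<in> \<Omega>"
  shows "A u x = A v x"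
proof -
  have "\<forall>u\<in>D. \<forall>v\<in>D. (\<forall>x\<in>\<Omega>. u x = v x) \<longrightarrow> (\<forall>x\<in>\<Omega>. A u x = A v x)"
    using assms(1) unfolding linear_operator_def by - (elim conjE)
  from this[rule_format, OF assms(2-5)] show ?thesis .
qed

lemma linear_operator_lincomb:
  assumes "function_space \<Omega> D" "linear_operator \<Omega> D A" "u \<in> D" "v \<in> D" "x \<in> \<Omega>"
  shows "A (\<lambda>y. s *\<^sub>R u y + t *\<^sub>R v y) x = s *\<^sub>R A u x + t *\<^sub>R A v x"
proof -
  have add: "\<forall>u\<in>D. \<forall>v\<in>D. \<forall>x\<in>\<Omega>. A (\<lambda>y. u y + v y) x = A u x + A v x"
    and scale: "\<forall>c. \<forall>u\<in>D. \<forall>x\<in>\<Omega>. A (\<lambda>y. c *\<^sub>R u y) x = c *\<^sub>R A u x"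
    using assms(2) unfolding linear_operator_def by - (elim conjE, assumption)+
  note scaled = function_space_scaleR[OF assms(1)]
  have "A (\<lambda>y. s *\<^sub>R u y + t *\<^sub>R v y) x = A (\<lambda>y. s *\<^sub>R u y) x + A (\<lambda>y. t *\<^sub>R v y) x"
    by (rule add[rule_format, OF scaled[OF assms(3)] scaled[OF assms(4)] assms(5)])
  also have "\<dots> = s *\<^sub>R A u x + t *\<^sub>R A v x"
    by (simp only: scale[rule_format, OF assms(3,5)] scale[rule_format, OF assms(4,5)])
  finally show ?thesis .
qed


section \<open>Adjointness and dissipation\<close>

text \<open>In finite dimension bilinearity already gives boundedness, which makes the product rule
  available for the flux \<open>v v* F\<close>.\<close>

lemma bounded_bilinear_vector_matrix_mult:
  "bounded_bilinear (\<lambda>(v::real^'m) (A::real^'d^'m). v v* A)"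
proof -
  have "bilinear (\<lambda>(v::real^'m) (A::real^'d^'m). v v* A)"
    unfolding bilinear_def
    by (auto intro!: linearI simp: vector_matrix_mult_def vec_eq_iff algebra_simps
        sum.distrib sum_distrib_left)
  then show ?thesis
    by (simp add: bilinear_conv_bounded_bilinear)
qed

text \<open>This is the local form of integration by parts. The derivative of the bilinear product
  has one term with the derivative of \<open>F\<close> and one with that of \<open>v\<close>; taking
  the trace turns them into the two contractions on the right.\<close>

lemma divergence_vector_matrix_mult:
  fixes v :: "real^'d \<Rightarrow> real^'m" and F :: "real^'d \<Rightarrow> real^'d^'m"
  assumes v: "v differentiable at x" and F: "F differentiable at x"
  shows "divergence (\<lambda>y. v y v* F y) x = row_divergence F x \<bullet> v x + F x \<bullet> nabla v x"
proof -
  define v' where "v' = frechet_derivative v (at x)"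
  define F' where "F' = frechet_derivative F (at x)"
  have v': "(v has_derivative v') (at x)" and F': "(F has_derivative F') (at x)"
    using v F by (simp_all add: v'_def F'_def frechet_derivative_works)
  have "((\<lambda>y. v y v* F y) has_derivative (\<lambda>h. v x v* F' h + v' h v* F x)) (at x)"
    by (rule bounded_bilinear.FDERIV[OF bounded_bilinear_vector_matrix_mult v' F'])
  note D = frechet_derivative_at[OF this, symmetric]
  have "divergence (\<lambda>y. v y v* F y) x
      = (\<Sum>j\<in>UNIV. (v x v* F' (axis j 1) + v' (axis j 1) v* F x) $ j)"
    by (simp add: divergence_def jacobian_def trace_def matrix_def D)
  also have "\<dots> = (\<Sum>j\<in>UNIV. \<Sum>i\<in>UNIV. F' (axis j 1) $ i $ j * v x $ i)
      + (\<Sum>j\<in>UNIV. \<Sum>i\<in>UNIV. F x $ i $ j * v' (axis j 1) $ i)"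
    by (simp add: vector_matrix_mult_def sum.distrib mult.commute)
  also have "(\<Sum>j\<in>UNIV. \<Sum>i\<in>UNIV. F' (axis j 1) $ i $ j * v x $ i) = row_divergence F x \<bullet> v x"
  proof -
    \<comment> \<open>Taking the i-th row is linear, so it commutes with differentiation; this
      identifies the divergence of each row with a partial trace of \<open>F'\<close>.\<close>
    have "((\<lambda>y. F y $ i) has_derivative (\<lambda>h. F' h $ i)) (at x)" for i
      by (rule bounded_linear.has_derivative[OF bounded_linear_vec_nth F'])
    then have "frechet_derivative (\<lambda>y. F y $ i) (at x) = (\<lambda>h. F' h $ i)" for i
      using frechet_derivative_at by metis
    then show ?thesis
      by (subst sum.swap) (simp add: row_divergence_def divergence_def jacobian_def trace_def matrix_def
          inner_vec_def sum_distrib_right)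
  qed
  also have "(\<Sum>j\<in>UNIV. \<Sum>i\<in>UNIV. F x $ i $ j * v' (axis j 1) $ i) = F x \<bullet> nabla v x"
    by (subst sum.swap) (simp add: nabla_def jacobian_def matrix_def inner_vec_def v'_def)
  finally show ?thesis .
qed

lemma fst_lincomb_comp:
  "fst \<circ> (\<lambda>x. s *\<^sub>R \<Psi> x + t *\<^sub>R \<Psi>' x) = (\<lambda>x. s *\<^sub>R (fst \<circ> \<Psi>) x + t *\<^sub>R (fst \<circ> \<Psi>') x)"
  by auto

lemma snd_lincomb_comp:
  "snd \<circ> (\<lambda>x. s *\<^sub>R \<Psi> x + t *\<^sub>R \<Psi>' x) = (\<lambda>x. s *\<^sub>R (snd \<circ> \<Psi>) x + t *\<^sub>R (snd \<circ> \<Psi>') x)"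
  by auto

context quadratization_model
begin

lemma state_space_lincomb:
  assumes "\<Psi> \<in> state_space V W" "\<Psi>' \<in> state_space V W"
  shows "(\<lambda>x. s *\<^sub>R \<Psi> x + t *\<^sub>R \<Psi>' x) \<in> state_space V W"
  using assms function_space_lincomb[OF spaces(1)] function_space_lincomb[OF spaces(3)]
  unfolding state_space_def by (simp only: mem_Collect_eq fst_lincomb_comp snd_lincomb_comp)

lemma L_op_components:
  "fst \<circ> L_op L0 \<Psi> = L0 (fst \<circ> \<Psi>)" "snd \<circ> L_op L0 \<Psi> = snd \<circ> \<Psi>"
  by (auto simp: L_op_def)

lemma L_op_L2:
  assumes "\<Psi> \<in> state_space V W"
  shows "fst \<circ> L_op L0 \<Psi> \<in> L2 \<Omega>" "snd \<circ> L_op L0 \<Psi> \<in> L2 \<Omega>"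
  using assms linear_operator_L2[OF L0(1)] function_space_L2[OF spaces(3)]
  by (auto simp: L_op_components state_space_def)

text \<open>By the product rule the two integrands differ by the divergence of the flux q G^T v,
  whose integral over \<Omega> is zero by \<open>no_boundary_term\<close>.\<close>

lemma N0_adjoint:
  assumes \<phi>: "\<phi> \<in> V" and \<Psi>: "\<Psi> \<in> state_space V W" and v: "v \<in> T"
  shows "l2_inner \<Omega> (L_op L0 \<Psi>) (N0_adj Q \<phi> v) = l2_inner \<Omega> (N0 Q \<phi> (L_op L0 \<Psi>)) v"
proof -
  let ?f = "L_op L0 \<Psi>" and ?F = "\<lambda>y. snd (\<Psi> y) *\<^sub>R G_fun Q \<phi> y"
  let ?div = "divergence (\<lambda>y. v y v* ?F y)"
  have q: "snd \<circ> \<Psi> \<in> W"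
    using \<Psi> by (simp add: state_space_def)
  have div: "has_bochner_integral (lebesgue_on \<Omega>) ?div 0"
    using no_boundary_term[OF \<phi> q v] by simp
  have product_rule: "?div x = row_divergence ?F x \<bullet> v x + ?F x \<bullet> nabla v x" if "x \<in> \<Omega>" for x
    using regular_T(1)[OF v that] regular_flux[OF \<phi> q that]
    by (intro divergence_vector_matrix_mult) simp_all
  have pointwise: "N0 Q \<phi> ?f x \<bullet> v x = ?f x \<bullet> N0_adj Q \<phi> v x - ?div x" if "x \<in> \<Omega>" for x
    using product_rule[OF that]
    by (simp add: N0_def N0_adj_def L_op_def inner_prod_def algebra_simps inner_add_left
        inner_diff_left)
  \<comment> \<open>Integrability of this pairing, together with that of \<open>?div\<close>, allows
    the integral of the difference to be split.\<close>
  have "integrable (lebesgue_on \<Omega>) (\<lambda>x. ?f x \<bullet> N0_adj Q \<phi> v x)"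
    by (rule integrable_inner_L2[OF L2_pairI[OF L_op_L2[OF \<Psi>]] regular_T(2)[OF \<phi> v]])
  then have "(LINT x|lebesgue_on \<Omega>. ?f x \<bullet> N0_adj Q \<phi> v x - ?div x) = l2_inner \<Omega> ?f (N0_adj Q \<phi> v)"
    using div by (simp add: l2_inner_def has_bochner_integral_iff)
  moreover have "l2_inner \<Omega> (N0 Q \<phi> ?f) v = (LINT x|lebesgue_on \<Omega>. ?f x \<bullet> N0_adj Q \<phi> v x - ?div x)"
    unfolding l2_inner_def by (intro Bochner_Integration.integral_cong) (auto simp: pointwise)
  ultimately show ?thesis
    by simp
qed

text \<open>Skew-symmetry makes the pairing of \<open>\<mu>\<close> with \<open>Ga \<mu>\<close>
  equal to its own negative, so only the positive semi-definite part contributes.\<close>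

lemma mobility_dissipative:
  assumes "\<mu> \<in> D"
  shows "0 \<le> l2_inner \<Omega> \<mu> (mobility Ga Gs \<mu>)"
proof -
  have "l2_inner \<Omega> \<mu> (mobility Ga Gs \<mu>) = l2_inner \<Omega> \<mu> (Ga \<mu>) + l2_inner \<Omega> \<mu> (Gs \<mu>)"
    using l2_inner_lincomb_right[OF linear_operator_L2[OF Ga(1) assms]
        linear_operator_L2[OF Gs(1) assms] function_space_L2[OF spaces(4) assms], of 1 1]
    by (simp add: mobility_def[abs_def])
  moreover have "l2_inner \<Omega> \<mu> (Ga \<mu>) = 0"
    using Ga(2) assms l2_inner_commute[of \<Omega> \<mu> "Ga \<mu>"] by (auto simp: skew_operator_def)
  ultimately show ?thesis
    using Gs(3) assms by (simp add: psd_operator_def)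
qed

text \<open>The coefficients are frozen at \<open>\<Phi>\<close> while the operator acts on
  \<open>\<Psi>\<close>. Since adjointness holds at any frozen phase field, evaluating the
  coefficients at the extrapolated state does not spoil dissipation at the midpoint.\<close>

lemma N_op_dissipative:
  assumes "\<Phi> \<in> state_space V W" "\<Psi> \<in> state_space V W"
  shows "0 \<le> l2_inner \<Omega> (L_op L0 \<Psi>) (N_op Ga Gs Q \<Phi> (L_op L0 \<Psi>))"
proof -
  have \<phi>: "fst \<circ> \<Phi> \<in> V"
    using assms by (simp add: state_space_def)
  then have "N0 Q (fst \<circ> \<Phi>) (L_op L0 \<Psi>) \<in> D"
    using N0_maps assms by blast
  then show ?thesis
    using N0_adjoint[OF \<phi> assms(2) mobility_maps] mobility_dissipative by (simp add: N_op_def)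
qed


section \<open>Energy balance of the first step\<close>

text \<open>For q = h(\<phi>) this is the original free energy shifted by the constant
  \<open>A0\<close>.\<close>

definition quadratic_energy :: "(real^'d \<Rightarrow> (real^'m) \<times> real) \<Rightarrow> real" where
  "quadratic_energy \<Psi> =
    1/2 * (l2_inner \<Omega> (fst \<circ> \<Psi>) (L0 (fst \<circ> \<Psi>)) + (l2_norm \<Omega> (snd \<circ> \<Psi>))\<^sup>2)"

text \<open>This is the difference of squares for a symmetric form: B((x+y)/2, x-y) = (B(x,x) -
  B(y,y))/2, applied once with \<open>L0\<close> to the phase fields and once with the identity to
  the auxiliary variables.\<close>

lemma midpoint_energy_identity:
  assumes "\<Phi> \<in> state_space V W" "\<Psi> \<in> state_space V W"
  shows "l2_inner \<Omega> (L_op L0 (\<lambda>x. (1/2) *\<^sub>R \<Phi> x + (1/2) *\<^sub>R \<Psi> x)) (\<lambda>x. \<Phi> x - \<Psi> x)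
    = quadratic_energy \<Phi> - quadratic_energy \<Psi>"
proof -
  let ?half = "\<lambda>x. (1/2) *\<^sub>R \<Phi> x + (1/2) *\<^sub>R \<Psi> x"
  let ?p = "fst \<circ> \<Phi>" and ?p' = "fst \<circ> \<Psi>" and ?q = "snd \<circ> \<Phi>" and ?q' = "snd \<circ> \<Psi>"
  have V: "?p \<in> V" "?p' \<in> V" and W: "?q \<in> W" "?q' \<in> W"
    using assms by (simp_all add: state_space_def)
  note VL2 = function_space_L2[OF spaces(1)] and WL2 = function_space_L2[OF spaces(3)]
    and L0L2 = linear_operator_L2[OF L0(1)]
  \<comment> \<open>The difference is written with coefficients 1 and -1 so that the rules for
    linear combinations apply.\<close>
  have diff: "(\<lambda>x. \<Phi> x - \<Psi> x) = (\<lambda>x. 1 *\<^sub>R \<Phi> x + (-1) *\<^sub>R \<Psi> x)"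
    by simp
  have d: "(\<lambda>x. \<Phi> x - \<Psi> x) \<in> state_space V W"
    unfolding diff by (rule state_space_lincomb[OF assms])
  have half: "?half \<in> state_space V W"
    by (rule state_space_lincomb[OF assms])
  have "l2_inner \<Omega> (L_op L0 ?half) (\<lambda>x. \<Phi> x - \<Psi> x)
      = l2_inner \<Omega> (L0 (fst \<circ> ?half)) (fst \<circ> (\<lambda>x. \<Phi> x - \<Psi> x))
        + l2_inner \<Omega> (snd \<circ> ?half) (snd \<circ> (\<lambda>x. \<Phi> x - \<Psi> x))"
    using d VL2 WL2 L_op_L2[OF half]
    by (subst l2_inner_pair) (simp_all only: L_op_components state_space_def mem_Collect_eq)
  also have "l2_inner \<Omega> (L0 (fst \<circ> ?half)) (fst \<circ> (\<lambda>x. \<Phi> x - \<Psi> x))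
      = l2_inner \<Omega> (\<lambda>x. (1/2) *\<^sub>R L0 ?p x + (1/2) *\<^sub>R L0 ?p' x) (\<lambda>x. 1 *\<^sub>R ?p x + (-1) *\<^sub>R ?p' x)"
  proof (rule l2_inner_cong)
    fix x assume "x \<in> \<Omega>"
    then show "L0 (fst \<circ> ?half) x = (1/2) *\<^sub>R L0 ?p x + (1/2) *\<^sub>R L0 ?p' x"
      unfolding fst_lincomb_comp by (rule linear_operator_lincomb[OF spaces(1) L0(1) V])
  qed simp
  also have "\<dots> = 1/2 * (l2_inner \<Omega> ?p (L0 ?p) - l2_inner \<Omega> ?p' (L0 ?p'))"
  proof -
    \<comment> \<open>The two mixed terms carry opposite signs, so their equality, due to
      self-adjointness of \<open>L0\<close>, cancels them.\<close>
    have sym: "l2_inner \<Omega> (L0 ?p) ?p' = l2_inner \<Omega> (L0 ?p') ?p"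
      using L0(2) V by (metis symmetric_operator_def l2_inner_commute)
    have dL2: "(\<lambda>x. 1 *\<^sub>R ?p x + (-1) *\<^sub>R ?p' x) \<in> L2 \<Omega>"
      by (intro VL2 function_space_lincomb[OF spaces(1)] V)
    show ?thesis
      unfolding l2_inner_lincomb_left[OF L0L2[OF V(1)] L0L2[OF V(2)] dL2]
        l2_inner_lincomb_right[OF VL2[OF V(1)] VL2[OF V(2)] L0L2[OF V(1)]]
        l2_inner_lincomb_right[OF VL2[OF V(1)] VL2[OF V(2)] L0L2[OF V(2)]]
      using sym by (simp add: l2_inner_commute[of \<Omega> _ "L0 _"] algebra_simps)
  qed
  also have "l2_inner \<Omega> (snd \<circ> ?half) (snd \<circ> (\<lambda>x. \<Phi> x - \<Psi> x))
      = 1/2 * (l2_inner \<Omega> ?q ?q - l2_inner \<Omega> ?q' ?q')"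
  proof -
    have dL2: "(\<lambda>x. 1 *\<^sub>R ?q x + (-1) *\<^sub>R ?q' x) \<in> L2 \<Omega>"
      by (intro WL2 function_space_lincomb[OF spaces(3)] W)
    show ?thesis
      unfolding diff snd_lincomb_comp l2_inner_lincomb_left[OF WL2[OF W(1)] WL2[OF W(2)] dL2]
        l2_inner_lincomb_right[OF WL2[OF W(1)] WL2[OF W(2)] WL2[OF W(1)]]
        l2_inner_lincomb_right[OF WL2[OF W(1)] WL2[OF W(2)] WL2[OF W(2)]]
      by (simp add: l2_inner_commute[of \<Omega> ?q' ?q] algebra_simps)
  qed
  finally show ?thesis
    unfolding quadratic_energy_def l2_norm_square by argo
qed

text \<open>The step equation is multiplied by \<open>\<delta>t\<close> and tested with
  \<open>L_op L0\<close> of the midpoint; the midpoint identity evaluates the left-hand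
  side.\<close>

lemma quadratic_energy_first_step:
  assumes "\<Phi> \<in> state_space V W" "\<Psi> \<in> state_space V W" "\<delta>t > 0"
    and step: "\<forall>x\<in>\<Omega>. (\<Phi> x - \<Psi> x) /\<^sub>R \<delta>t = - R x"
  shows "quadratic_energy \<Phi> = quadratic_energy \<Psi>
    - \<delta>t * l2_inner \<Omega> (L_op L0 (\<lambda>x. (1/2) *\<^sub>R \<Phi> x + (1/2) *\<^sub>R \<Psi> x)) R"
proof -
  let ?L = "L_op L0 (\<lambda>x. (1/2) *\<^sub>R \<Phi> x + (1/2) *\<^sub>R \<Psi> x)"
  have "\<Phi> x - \<Psi> x = (- \<delta>t) *\<^sub>R R x" if "x \<in> \<Omega>" for x
  proof -
    have "\<Phi> x - \<Psi> x = \<delta>t *\<^sub>R ((\<Phi> x - \<Psi> x) /\<^sub>R \<delta>t)"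
      using \<open>\<delta>t > 0\<close> by simp
    then show ?thesis
      using step that by simp
  qed
  then have "l2_inner \<Omega> ?L (\<lambda>x. \<Phi> x - \<Psi> x) = l2_inner \<Omega> ?L (\<lambda>x. (- \<delta>t) *\<^sub>R R x)"
    by (intro l2_inner_cong refl)
  also have "\<dots> = - \<delta>t * l2_inner \<Omega> ?L R"
    by (simp add: l2_inner_def)
  finally show ?thesis
    using midpoint_energy_identity[OF assms(1,2)] by simp
qed

end


section \<open>The relaxation step\<close>

text \<open>Completing the square gives 4a(a \<xi>^2 + b \<xi> + c) = (2a \<xi> + b)^2 - (b^2 -
  4ac). The claim therefore reduces to |2a \<xi> + b| <= s, with s the root of the
  discriminant.\<close>

lemma quadratic_nonpos_at_clipped_root:
  fixes a b c :: real
  assumes "a > 0" "a + b + c \<le> 0" and \<xi>: "\<xi> = max 0 ((- b - sqrt (b\<^sup>2 - 4 * a * c)) / (2 * a))"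
  shows "a * \<xi>\<^sup>2 + b * \<xi> + c \<le> 0"
proof -
  define s where "s = sqrt (b\<^sup>2 - 4 * a * c)"
  \<comment> \<open>The same identity at \<xi> = 1 shows that the discriminant is nonnegative and
    that |2a + b| <= s.\<close>
  have "(2 * a + b)\<^sup>2 = 4 * a * (a + b + c) + (b\<^sup>2 - 4 * a * c)"
    by (simp add: power2_eq_square algebra_simps)
  moreover have "4 * a * (a + b + c) \<le> 0"
    using assms by (simp add: mult_nonneg_nonpos)
  ultimately have disc: "(2 * a + b)\<^sup>2 \<le> b\<^sup>2 - 4 * a * c"
    by simp
  then have s: "\<bar>2 * a + b\<bar> \<le> s"
    unfolding s_def by (rule real_le_rsqrt[of "\<bar>2 * a + b\<bar>", simplified])
  have "\<bar>2 * a * \<xi> + b\<bar> \<le> s"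
  proof (cases "- b - s \<ge> 0")
    case True
    then have "\<xi> = (- b - s) / (2 * a)"
      using \<xi> \<open>a > 0\<close> by (simp add: s_def max_def)
    then have "2 * a * \<xi> + b = - s"
      using \<open>a > 0\<close> by simp
    then show ?thesis
      using s by simp
  next
    \<comment> \<open>Here the smaller root is negative and clipping yields 0. The case assumption
      gives -b < s, while b < 2a + b <= s bounds the other sign.\<close>
    case False
    then have "\<xi> = 0"
      using \<xi> \<open>a > 0\<close> by (simp add: s_def max_def zero_le_divide_iff)
    then show ?thesis
      using False s \<open>a > 0\<close> by simp
  qed
  then have "(2 * a * \<xi> + b)\<^sup>2 \<le> s\<^sup>2"
    by (simp add: abs_le_square_iff[symmetric])
  also have "s\<^sup>2 = b\<^sup>2 - 4 * a * c"
    unfolding s_def using disc by (intro real_sqrt_pow2) (meson order_trans zero_le_power2)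
  finally have "4 * a * (a * \<xi>\<^sup>2 + b * \<xi> + c) \<le> 0"
    by (simp add: power2_eq_square algebra_simps)
  then show ?thesis
    using \<open>a > 0\<close> by (simp add: mult_le_0_iff)
qed

text \<open>The coefficients are chosen so that half the squared norm of the blend equals half that
  of \<open>qh\<close>, plus \<open>d\<close>, plus the quadratic polynomial at
  \<open>\<xi>\<close>. Nonpositivity of the polynomial is thus exactly the bound.\<close>

lemma relaxation_bound:
  assumes W: "function_space \<Omega> W" "qh \<in> W" "h \<in> W" and "0 \<le> d"
    and \<xi>: "relax_a \<Omega> qh h \<noteq> 0 \<longrightarrow> \<xi> = max 0 ((- relax_b \<Omega> qh h
      - sqrt ((relax_b \<Omega> qh h)\<^sup>2 - 4 * relax_a \<Omega> qh h * relax_c \<Omega> qh h d)) / (2 * relax_a \<Omega> qh h))"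
  shows "(l2_norm \<Omega> (\<lambda>x. \<xi> * qh x + (1 - \<xi>) * h x))\<^sup>2 \<le> (l2_norm \<Omega> qh)\<^sup>2 + 2 * d"
proof -
  define a b c where "a = relax_a \<Omega> qh h" and "b = relax_b \<Omega> qh h" and "c = relax_c \<Omega> qh h d"
  note L2 = function_space_L2[OF W(1)]
  let ?A = "l2_inner \<Omega> qh qh" and ?B = "l2_inner \<Omega> qh h" and ?C = "l2_inner \<Omega> h h"
  have expand: "l2_inner \<Omega> (\<lambda>x. s *\<^sub>R qh x + t *\<^sub>R h x) (\<lambda>x. s *\<^sub>R qh x + t *\<^sub>R h x)
      = s\<^sup>2 * ?A + 2 * s * t * ?B + t\<^sup>2 * ?C" for s t
    unfolding l2_inner_lincomb_left[OF L2[OF W(2)] L2[OF W(3)]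
        L2[OF function_space_lincomb[OF W]]]
      l2_inner_lincomb_right[OF L2[OF W(2)] L2[OF W(3)] L2[OF W(2)]]
      l2_inner_lincomb_right[OF L2[OF W(2)] L2[OF W(3)] L2[OF W(3)]]
    by (simp add: l2_inner_commute[of \<Omega> h qh] power2_eq_square algebra_simps)
  have a_eq: "a = 1/2 * (?A - 2 * ?B + ?C)"
    using expand[of 1 "-1"] by (simp add: a_def relax_a_def l2_norm_square)
  have b_eq: "b = ?B - ?C"
    by (simp add: b_def relax_b_def l2_norm_square)
  have c_eq: "c = 1/2 * ?C - 1/2 * ?A - d"
    by (simp add: c_def relax_c_def l2_norm_square)
  \<comment> \<open>At \<xi> = 1 the blend is \<open>qh\<close> itself and the polynomial takes the
    value -d.\<close>
  have at_1: "a + b + c \<le> 0"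
    using \<open>0 \<le> d\<close> by (simp add: a_eq b_eq c_eq field_simps)
  have "a * \<xi>\<^sup>2 + b * \<xi> + c \<le> 0"
  proof (cases "a = 0")
    \<comment> \<open>Here \<open>\<xi>\<close> is arbitrary, so the polynomial must be constant.
      Since \<open>qh - h\<close> has zero norm, its pairing with \<open>h\<close>, which is
      \<open>b\<close>, vanishes too, and the value at 1 is the value everywhere.\<close>
    case True
    let ?r = "\<lambda>x. 1 *\<^sub>R qh x + (-1) *\<^sub>R h x"
    have "?r \<in> L2 \<Omega>"
      by (intro L2 function_space_lincomb[OF W])
    moreover have "l2_inner \<Omega> ?r ?r = 0"
      using True unfolding expand by (simp add: a_eq)
    ultimately have "l2_inner \<Omega> ?r h = 0"
      by (rule l2_inner_eq_0_if_self_eq_0)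
    then have "b = 0"
      unfolding l2_inner_lincomb_left[OF L2[OF W(2)] L2[OF W(3)] L2[OF W(3)]] by (simp add: b_eq)
    then show ?thesis
      using at_1 True by simp
  next
    case False
    moreover have "a \<ge> 0"
      by (simp add: a_def relax_a_def)
    ultimately show ?thesis
      using \<xi> at_1 by (intro quadratic_nonpos_at_clipped_root) (simp_all add: a_def b_def c_def)
  qed
  moreover have "(l2_norm \<Omega> (\<lambda>x. \<xi> * qh x + (1 - \<xi>) * h x))\<^sup>2
      = \<xi>\<^sup>2 * ?A + 2 * \<xi> * (1 - \<xi>) * ?B + (1 - \<xi>)\<^sup>2 * ?C"
    using expand[of \<xi> "1 - \<xi>"] by (simp add: l2_norm_square)
  moreover have "\<xi>\<^sup>2 * ?A + 2 * \<xi> * (1 - \<xi>) * ?B + (1 - \<xi>)\<^sup>2 * ?C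
      = ?A + 2 * d + 2 * (a * \<xi>\<^sup>2 + b * \<xi> + c)"
    by (simp add: a_eq b_eq c_eq power2_eq_square field_simps)
  ultimately show ?thesis
    by (simp add: l2_norm_square)
qed


section \<open>Assembly of the two steps into the energy law\<close>

theorem theorem3p1:
  fixes \<Omega> :: "(real^'d) set"
    and V V' D T :: "(real^'d \<Rightarrow> real^'m) set"
    and W :: "(real^'d \<Rightarrow> real) set"
    and L0 L0half Ga Gs :: "(real^'d \<Rightarrow> real^'m) \<Rightarrow> real^'d \<Rightarrow> real^'m"
    and e :: "(real^'d \<Rightarrow> real^'m) \<Rightarrow> real^'d \<Rightarrow> real"
    and A0 \<delta>t \<eta> :: real
    and Q :: "real^'m \<Rightarrow> real^'d^'m \<Rightarrow> real"
    and \<Psi> :: "nat \<Rightarrow> real^'d \<Rightarrow> (real^'m) \<times> real"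
    and n :: nat
  assumes "quadratization_model \<Omega> V V' D T W L0 L0half Ga Gs e A0 Q"
    and "\<delta>t > 0" and "0 \<le> \<eta>" and "\<eta> \<le> 1" and "n \<ge> 1"
    and "\<Psi> (n - 1) \<in> state_space V W" and "\<Psi> n \<in> state_space V W"
    and "relaxed_CN_step \<Omega> V W L0 L0half Ga Gs e A0 Q \<delta>t \<eta> (\<Psi> (n - 1)) (\<Psi> n) (\<Psi> (n + 1))"
  shows "1/2 * (l2_inner \<Omega> (fst \<circ> \<Psi> (n + 1)) (L0 (fst \<circ> \<Psi> (n + 1)))
                  + (l2_norm \<Omega> (snd \<circ> \<Psi> (n + 1)))\<^sup>2)
         \<le> 1/2 * (l2_inner \<Omega> (fst \<circ> \<Psi> n) (L0 (fst \<circ> \<Psi> n))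
                  + (l2_norm \<Omega> (snd \<circ> \<Psi> n))\<^sup>2)"
proof -
  interpret quadratization_model \<Omega> V V' D T W L0 L0half Ga Gs e A0 Q
    by (rule assms(1))
  define \<Psi>bar where "\<Psi>bar = (\<lambda>x. (3/2) *\<^sub>R \<Psi> n x - (1/2) *\<^sub>R \<Psi> (n - 1) x)"
  obtain \<Psi>hat \<xi>0 where hat: "\<Psi>hat \<in> state_space V W"
    and scheme: "let \<Psi>half = (\<lambda>x. (1/2) *\<^sub>R \<Psi>hat x + (1/2) *\<^sub>R \<Psi> n x);
          L\<Psi> = L_op L0 \<Psi>half;
          NL\<Psi> = N_op Ga Gs Q \<Psi>bar L\<Psi>;
          qh = snd \<circ> \<Psi>hat;
          h = aux_h \<Omega> e L0half A0 (fst \<circ> \<Psi>hat);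
          a = relax_a \<Omega> qh h;
          b = relax_b \<Omega> qh h;
          c = relax_c \<Omega> qh h (\<delta>t * \<eta> * l2_inner \<Omega> L\<Psi> NL\<Psi>)
      in (\<forall>x\<in>\<Omega>. (\<Psi>hat x - \<Psi> n x) /\<^sub>R \<delta>t = - NL\<Psi> x) \<and>
         (a \<noteq> 0 \<longrightarrow> \<xi>0 = max 0 ((- b - sqrt (b\<^sup>2 - 4 * a * c)) / (2 * a))) \<and>
         (\<forall>x\<in>\<Omega>. \<Psi> (n + 1) x = (fst (\<Psi>hat x), \<xi>0 * qh x + (1 - \<xi>0) * h x))"
    using assms(8) unfolding relaxed_CN_step_def Let_def \<Psi>bar_def by (elim bexE exE)
  define \<Psi>half where "\<Psi>half = (\<lambda>x. (1/2) *\<^sub>R \<Psi>hat x + (1/2) *\<^sub>R \<Psi> n x)"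
  define R where "R = N_op Ga Gs Q \<Psi>bar (L_op L0 \<Psi>half)"
  define P where "P = l2_inner \<Omega> (L_op L0 \<Psi>half) R"
  define qh where "qh = snd \<circ> \<Psi>hat"
  define h where "h = aux_h \<Omega> e L0half A0 (fst \<circ> \<Psi>hat)"
  have step: "\<forall>x\<in>\<Omega>. (\<Psi>hat x - \<Psi> n x) /\<^sub>R \<delta>t = - R x"
    and \<xi>0: "relax_a \<Omega> qh h \<noteq> 0 \<longrightarrow> \<xi>0 = max 0 ((- relax_b \<Omega> qh h - sqrt ((relax_b \<Omega> qh h)\<^sup>2
        - 4 * relax_a \<Omega> qh h * relax_c \<Omega> qh h (\<delta>t * \<eta> * P))) / (2 * relax_a \<Omega> qh h))"
    and new: "\<And>x. x \<in> \<Omega> \<Longrightarrow> \<Psi> (n + 1) x = (fst (\<Psi>hat x), \<xi>0 * qh x + (1 - \<xi>0) * h x)"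
    using scheme unfolding Let_def \<Psi>half_def R_def P_def qh_def h_def by blast+
  have bar_eq: "\<Psi>bar = (\<lambda>x. (3/2) *\<^sub>R \<Psi> n x + (-1/2) *\<^sub>R \<Psi> (n - 1) x)"
    by (simp add: \<Psi>bar_def)
  have bar: "\<Psi>bar \<in> state_space V W"
    unfolding bar_eq by (rule state_space_lincomb[OF assms(7,6)])
  have half: "\<Psi>half \<in> state_space V W"
    unfolding \<Psi>half_def by (rule state_space_lincomb[OF hat assms(7)])
  \<comment> \<open>The dissipation of the first step has a sign whatever the size of
    \<open>\<delta>t\<close>, which is why stability is unconditional.\<close>
  have P: "0 \<le> P"
    unfolding P_def R_def by (rule N_op_dissipative[OF bar half])
  have V: "fst \<circ> \<Psi>hat \<in> V" and qh: "qh \<in> W"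
    using hat by (simp_all add: state_space_def qh_def)
  have h: "h \<in> W"
    unfolding h_def by (rule regular_V(2)[OF V])
  have first: "quadratic_energy \<Psi>hat = quadratic_energy (\<Psi> n) - \<delta>t * P"
    unfolding P_def \<Psi>half_def by (rule quadratic_energy_first_step[OF hat assms(7,2) step])
  have "(l2_norm \<Omega> (snd \<circ> \<Psi> (n + 1)))\<^sup>2 = (l2_norm \<Omega> (\<lambda>x. \<xi>0 * qh x + (1 - \<xi>0) * h x))\<^sup>2"
    unfolding l2_norm_square using new by (intro l2_inner_cong) simp_all
  also have "\<dots> \<le> (l2_norm \<Omega> qh)\<^sup>2 + 2 * (\<delta>t * \<eta> * P)"
    using P assms(2,3) by (intro relaxation_bound[OF spaces(3) qh h _ \<xi>0]) simp
  finally have q_new: "(l2_norm \<Omega> (snd \<circ> \<Psi> (n + 1)))\<^sup>2 \<le> (l2_norm \<Omega> qh)\<^sup>2 + 2 * (\<delta>t * \<eta> * P)" .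
  \<comment> \<open>Relaxation leaves the phase field unchanged, but the scheme prescribes it only
    on \<Omega>; membership in \<open>V\<close> and the values of \<open>L0\<close> are therefore
    transferred by congruence on \<Omega>.\<close>
  have fst_new: "(fst \<circ> \<Psi> (n + 1)) x = (fst \<circ> \<Psi>hat) x" if "x \<in> \<Omega>" for x
    using new[OF that] by simp
  have V_new: "fst \<circ> \<Psi> (n + 1) \<in> V"
    by (rule function_space_cong[OF spaces(1) V fst_new])
  have "l2_inner \<Omega> (fst \<circ> \<Psi> (n + 1)) (L0 (fst \<circ> \<Psi> (n + 1)))
      = l2_inner \<Omega> (fst \<circ> \<Psi>hat) (L0 (fst \<circ> \<Psi>hat))"
    by (intro l2_inner_cong linear_operator_cong[OF L0(1) V_new V] fst_new)
  then have "quadratic_energy (\<Psi> (n + 1)) \<le> quadratic_energy \<Psi>hat + \<delta>t * \<eta> * P"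
    using q_new by (simp add: quadratic_energy_def qh_def field_simps)
  \<comment> \<open>With \<open>\<eta>\<close> at most 1, relaxation returns no more energy than the
    first step has dissipated.\<close>
  moreover have "\<delta>t * \<eta> * P \<le> \<delta>t * P"
    using P assms(2,4) by (intro mult_right_mono mult_left_le) simp_all
  ultimately have "quadratic_energy (\<Psi> (n + 1)) \<le> quadratic_energy (\<Psi> n)"
    using first by linarith
  then show ?thesis
    by (simp only: quadratic_energy_def)
qed

end
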